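(* Let $G$ be a finite non-abelian group. The commuting graph $\Gamma(G)$ has maximum vertex degree at most $2$ if and only if $G$ is isomorphic to one of the following groups: $S_3$, $A_4$, $D_8$, $Q_8$.
   Context: For a finite non-abelian group $G$ with center $Z(G)$, the commuting graph $\Gamma(G)$ is the simple graph whose vertex set is $G\setminus Z(G)$ and in which two distinct vertices $x,y$ are adjacent if and only if $xy=yx$. $D_8$ is the dihedral group of order 8 and $Q_8$ the quaternion group of order 8. *)

theory Defs
  imports "HOL-Algebra.Sym_Groups" "Graph_Theory.Pair_Digraph"
begin

definition center :: "('a, 'b) monoid_scheme \<Rightarrow> 'a set" where
  "center G = {z \<in> carrier G. \<forall>x \<in> carrier G. z \<otimes>\<^bsub>G\<^esub> x = x \<otimes>\<^bsub>G\<^esub> z}"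

text \<open>A simple graph is represented by a symmetric loop-free digraph: an edge between \<open>x\<close> and
  \<open>y\<close> is the pair of opposite arcs \<open>(x, y)\<close> and \<open>(y, x)\<close>.\<close>

definition commuting_graph :: "('a, 'b) monoid_scheme \<Rightarrow> 'a pair_pre_digraph" where
  "commuting_graph G =
     \<lparr> pverts = carrier G - center G,
       parcs = {(x, y). x \<in> carrier G - center G \<and> y \<in> carrier G - center G \<and>
                        x \<noteq> y \<and> x \<otimes>\<^bsub>G\<^esub> y = y \<otimes>\<^bsub>G\<^esub> x} \<rparr>"

lemma pair_graph_commuting_graph:
  assumes "finite (carrier G)"
  shows "pair_graph (commuting_graph G)"
proof -
  have "parcs (commuting_graph G) \<subseteq> carrier G \<times> carrier G"
    by (auto simp: commuting_graph_def)
  then have "finite (parcs (commuting_graph G))"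
    using assms by (meson finite_SigmaI finite_subset)
  then show ?thesis
    using assms
    by unfold_locales (auto simp: commuting_graph_def symmetric_def intro!: symI)
qed

text \<open>In a symmetric digraph the number of arcs leaving a vertex is its degree in the underlying
  undirected graph.  As \<open>Max {}\<close> is unspecified, the maximum degree is meaningful for a finite
  graph with at least one vertex only; the commuting graph of a finite non-abelian group is one.\<close>

definition max_degree :: "('a, 'b) pre_digraph \<Rightarrow> nat" where
  "max_degree \<Gamma> = Max (out_degree \<Gamma> ` verts \<Gamma>)"

lemma out_degree_commuting_graph:
  assumes "x \<in> carrier G - center G"
  shows "out_degree (with_proj (commuting_graph G)) x =
    card {y \<in> carrier G - center G. y \<noteq> x \<and> x \<otimes>\<^bsub>G\<^esub> y = y \<otimes>\<^bsub>G\<^esub> x}"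
proof -
  have "out_arcs (with_proj (commuting_graph G)) x =
      Pair x ` {y \<in> carrier G - center G. y \<noteq> x \<and> x \<otimes>\<^bsub>G\<^esub> y = y \<otimes>\<^bsub>G\<^esub> x}"
    using assms by (auto simp: out_arcs_def commuting_graph_def)
  then show ?thesis
    by (simp add: out_degree_def card_image inj_on_def)
qed

lemma verts_commuting_graph_nonempty:
  assumes "group G" "\<not> comm_group G"
  shows "pverts (commuting_graph G) \<noteq> {}"
proof
  assume "pverts (commuting_graph G) = {}"
  then have "\<And>x y. x \<in> carrier G \<Longrightarrow> y \<in> carrier G \<Longrightarrow> x \<otimes>\<^bsub>G\<^esub> y = y \<otimes>\<^bsub>G\<^esub> x"
    by (auto simp: commuting_graph_def center_def)
  then show False
    using assms group.group_comm_groupI by blast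
qed

text \<open>The dihedral group of order \<open>2 n\<close>.  The pair \<open>(i, s)\<close> stands for \<open>r\<^sup>i\<close> if \<open>s\<close> is false and
  for \<open>r\<^sup>i f\<close> if \<open>s\<close> is true, where \<open>r\<close> is the rotation of order \<open>n\<close>, \<open>f\<close> a reflection, and
  \<open>f r = r\<inverse> f\<close>.\<close>

definition dihedral_group :: "nat \<Rightarrow> (int \<times> bool) monoid" where
  "dihedral_group n =
     \<lparr> carrier = {0..<int n} \<times> UNIV,
       mult = (\<lambda>(i, s) (j, t). ((if s then i - j else i + j) mod int n, s \<noteq> t)),
       one = (0, False) \<rparr>"

lemma group_dihedral_group:
  assumes "n > 0"
  shows "group (dihedral_group n)"
proof (rule groupI)
  fix x y z
  assume "x \<in> carrier (dihedral_group n)" "y \<in> carrier (dihedral_group n)"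
    "z \<in> carrier (dihedral_group n)"
  then show "x \<otimes>\<^bsub>dihedral_group n\<^esub> y \<otimes>\<^bsub>dihedral_group n\<^esub> z =
      x \<otimes>\<^bsub>dihedral_group n\<^esub> (y \<otimes>\<^bsub>dihedral_group n\<^esub> z)"
    by (auto simp: dihedral_group_def mod_simps algebra_simps)
next
  fix x
  assume x: "x \<in> carrier (dihedral_group n)"
  obtain i s where xi: "x = (i, s)" by (cases x)
  show "\<exists>y \<in> carrier (dihedral_group n).
      y \<otimes>\<^bsub>dihedral_group n\<^esub> x = \<one>\<^bsub>dihedral_group n\<^esub>"
    using assms x
    by (intro bexI[of _ "((if s then i else - i) mod int n, s)"])
      (auto simp: xi dihedral_group_def mod_simps)
qed (use assms in \<open>auto simp: dihedral_group_def\<close>)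

lemma order_dihedral_group: "order (dihedral_group n) = 2 * n"
  by (simp add: order_def dihedral_group_def card_cartesian_product)

text \<open>The quaternion \<open>a + b i + c j + d k\<close> is the quadruple \<open>(a, b, c, d)\<close>.\<close>

type_synonym int_quaternion = "int \<times> int \<times> int \<times> int"

fun hamilton_mult :: "int_quaternion \<Rightarrow> int_quaternion \<Rightarrow> int_quaternion" where
  "hamilton_mult (a, b, c, d) (a', b', c', d') =
     (a * a' - b * b' - c * c' - d * d',
      a * b' + b * a' + c * d' - d * c',
      a * c' - b * d' + c * a' + d * b',
      a * d' + b * c' - c * b' + d * a')"

text \<open>The group \<open>{1, -1, i, -i, j, -j, k, -k}\<close>.\<close>

definition quaternion_group :: "int_quaternion monoid" where
  "quaternion_group =
     \<lparr> carrier = {(1, 0, 0, 0), (-1, 0, 0, 0), (0, 1, 0, 0), (0, -1, 0, 0),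
                  (0, 0, 1, 0), (0, 0, -1, 0), (0, 0, 0, 1), (0, 0, 0, -1)},
       mult = hamilton_mult,
       one = (1, 0, 0, 0) \<rparr>"

lemma quaternion_relations:
  "hamilton_mult (0, 1, 0, 0) (0, 1, 0, 0) = (-1, 0, 0, 0)"
  "hamilton_mult (0, 0, 1, 0) (0, 0, 1, 0) = (-1, 0, 0, 0)"
  "hamilton_mult (0, 0, 0, 1) (0, 0, 0, 1) = (-1, 0, 0, 0)"
  "hamilton_mult (hamilton_mult (0, 1, 0, 0) (0, 0, 1, 0)) (0, 0, 0, 1) = (-1, 0, 0, 0)"
  by simp_all

lemma group_quaternion_group: "group quaternion_group"
proof (rule groupI)
  fix x y z :: int_quaternion
  show "x \<otimes>\<^bsub>quaternion_group\<^esub> y \<otimes>\<^bsub>quaternion_group\<^esub> z =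
      x \<otimes>\<^bsub>quaternion_group\<^esub> (y \<otimes>\<^bsub>quaternion_group\<^esub> z)"
    by (cases x; cases y; cases z) (simp add: quaternion_group_def algebra_simps)
qed (auto simp: quaternion_group_def)

lemma order_quaternion_group: "order quaternion_group = 8"
  by (simp add: order_def quaternion_group_def)

end

theory Submission
  imports Defs "HOL-Algebra.Group_Action" "HOL-Algebra.Multiplicative_Group"
begin

text \<open>
  Counting the neighbours of a non-central \<open>x\<close> gives \<open>|C(x)| - |Z| - 1\<close>, where \<open>C(x)\<close> is its
  centralizer and \<open>Z\<close> the center.  The degree condition therefore says that \<open>|C(x)| \<le> |Z| + 3\<close> for
  all non-central \<open>x\<close>.

  For the four groups, the order does almost all the work: \<open>C(x)\<close> is a proper subgroup, so
  \<open>|C(x)| \<le> |G| / 2 \<le> 4\<close> when \<open>|G| \<le> 9\<close>.  In \<open>A\<^sub>4\<close> only \<open>|C(x)| = 6\<close> has to be excluded, and an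
  alternating group has no subgroup of index two: such a subgroup contains all squares, hence all
  3-cycles.

  Conversely, assume the degree condition.  As \<open>|Z|\<close> divides \<open>|C(x)|\<close> properly, only \<open>|Z| \<le> 3\<close> can
  occur.

  If \<open>Z\<close> is trivial, then \<open>|C(x)| \<in> {2, 3, 4}\<close> for \<open>x \<noteq> 1\<close>, and the class equation leaves
  \<open>|G| = 6\<close> with a class of size 3 or \<open>|G| = 12\<close> with a class of size 4.  Conjugation on that class
  is faithful, since an element acting trivially would have too large a centralizer.  So \<open>G\<close> embeds
  into \<open>S\<^sub>3\<close> as the whole group, or into \<open>S\<^sub>4\<close> as a subgroup of index two, which can only be \<open>A\<^sub>4\<close>.

  If \<open>Z\<close> is not trivial, then \<open>|C(x)| = 2 |Z|\<close>, so \<open>x\<^sup>2 \<in> Z\<close> for every \<open>x\<close>.  All commutators are then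
  central of order at most two, which is impossible for \<open>|Z| = 3\<close> in a non-abelian group.  Thus
  \<open>Z = {1, z}\<close>, a class has at most the two elements \<open>x\<close> and \<open>z x\<close>, and \<open>|G| = 8\<close>.  The squares of
  two non-commuting elements decide between \<open>D\<^sub>8\<close> and \<open>Q\<^sub>8\<close>.
\<close>

section \<open>Centralizers and degrees\<close>

definition centralizer :: "('a, 'b) monoid_scheme \<Rightarrow> 'a \<Rightarrow> 'a set" where
  "centralizer G x = {g \<in> carrier G. g \<otimes>\<^bsub>G\<^esub> x = x \<otimes>\<^bsub>G\<^esub> g}"

context group
begin

abbreviation conj_action :: "'a \<Rightarrow> 'a \<Rightarrow> 'a" where
  "conj_action \<equiv> \<lambda>g. \<lambda>h \<in> carrier G. g \<otimes> h \<otimes> inv g"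

lemma conj_eq_iff:
  assumes "g \<in> carrier G" "x \<in> carrier G" "y \<in> carrier G"
  shows "g \<otimes> x \<otimes> inv g = y \<longleftrightarrow> g \<otimes> x = y \<otimes> g"
  using assms inv_solve_right' by (metis m_closed)

lemma stabilizer_conj_action:
  assumes "x \<in> carrier G"
  shows "stabilizer G conj_action x = centralizer G x"
  unfolding stabilizer_def centralizer_def
  by (rule Collect_cong) (use assms conj_eq_iff in auto)

lemma subgroup_centralizer:
  assumes "x \<in> carrier G"
  shows "subgroup (centralizer G x) G"
  using group_action.stabilizer_subgroup[OF action_by_conjugation assms]
  by (simp add: stabilizer_conj_action assms)

lemma subgroup_center: "subgroup (center G) G"
proof -
  have "center G = (\<Inter>x \<in> carrier G. centralizer G x)"
    by (auto simp: center_def centralizer_def)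
  moreover have "subgroup (\<Inter>x \<in> carrier G. centralizer G x) G"
    by (rule subgroups_Inter) (auto intro: subgroup_centralizer)
  ultimately show ?thesis by simp
qed

lemma in_centralizer_self: "x \<in> carrier G \<Longrightarrow> x \<in> centralizer G x"
  by (simp add: centralizer_def)

lemma center_subset_centralizer: "x \<in> carrier G \<Longrightarrow> center G \<subseteq> centralizer G x"
  by (auto simp: center_def centralizer_def)

lemma centralizer_eq_carrier_iff:
  "x \<in> carrier G \<Longrightarrow> centralizer G x = carrier G \<longleftrightarrow> x \<in> center G"
  unfolding center_def centralizer_def by (auto dest!: equalityD2 dest: sym)

lemma subgroup_card_dvd:
  assumes "subgroup H G" "subgroup K G" "H \<subseteq> K"
  shows "card H dvd card K"
proof -
  interpret K: group "G\<lparr>carrier := K\<rparr>"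
    by (rule subgroup_imp_group[OF assms(2)])
  have "subgroup H (G\<lparr>carrier := K\<rparr>)"
    using assms subgroup_incl by blast
  from K.lagrange[OF this] have "card K = card (rcosets\<^bsub>G\<lparr>carrier := K\<rparr>\<^esub> H) * card H"
    by (simp add: order_def)
  then show ?thesis by simp
qed

lemma card_proper_subgroup:
  assumes "subgroup H G" "subgroup K G" "H \<subset> K" "finite K"
  shows "2 * card H \<le> card K"
proof -
  obtain k where k: "card K = card H * k"
    using subgroup_card_dvd[OF assms(1,2)] assms(3) by (auto elim: dvdE)
  have "card H < card K"
    by (rule psubset_card_mono[OF assms(4,3)])
  then have "k \<noteq> 0" "k \<noteq> 1" using k by auto
  then have "2 \<le> k" by linarith
  then show ?thesis using k mult_le_mono1[of 2 k "card H"] by (simp add: mult.commute)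
qed

text \<open>Otherwise \<open>K\<close> is the disjoint union of \<open>H\<close> and the coset \<open>H x\<close>, and \<open>x x \<in> H x\<close> would put \<open>x\<close>
  into \<open>H\<close>.\<close>

lemma square_mem_index_two:
  assumes H: "subgroup H G" and K: "subgroup K G" and "H \<subseteq> K"
    and "finite K" "card K = 2 * card H" "x \<in> K"
  shows "x \<otimes> x \<in> H"
proof (cases "x \<in> H")
  case True
  then show ?thesis using H by (simp add: subgroup.m_closed)
next
  case False
  have car: "H \<subseteq> carrier G" "K \<subseteq> carrier G" "x \<in> carrier G"
    using subgroup.subset[OF H] subgroup.subset[OF K] assms by auto
  have fin: "finite H" using assms finite_subset by blast
  have not_coset: "h \<otimes> x \<notin> H" if "h \<in> H" for h
  proof
    assume "h \<otimes> x \<in> H"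
    then have "inv h \<otimes> (h \<otimes> x) \<in> H"
      using H that by (simp add: subgroup.m_closed subgroup.m_inv_closed)
    moreover have "inv h \<otimes> (h \<otimes> x) = x"
      using car that m_assoc[of "inv h" h x] by (auto simp: subset_iff)
    ultimately show False using False by simp
  qed
  have inj: "inj_on (\<lambda>h. h \<otimes> x) H"
    using inj_on_multc[OF car(3)] car(1) by (rule inj_on_subset)
  have "H \<union> (\<lambda>h. h \<otimes> x) ` H = K"
  proof (rule card_subset_eq)
    show "H \<union> (\<lambda>h. h \<otimes> x) ` H \<subseteq> K"
      using assms K by (auto intro!: subgroup.m_closed[OF K])
    have "H \<inter> (\<lambda>h. h \<otimes> x) ` H = {}" using not_coset by auto
    then show "card (H \<union> (\<lambda>h. h \<otimes> x) ` H) = card K"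
      using fin assms(5) by (simp add: card_Un_disjoint card_image[OF inj])
  qed (rule assms)
  then have "x \<otimes> x \<in> H \<union> (\<lambda>h. h \<otimes> x) ` H"
    using K assms(6) by (simp add: subgroup.m_closed)
  moreover have "x \<otimes> x \<noteq> h \<otimes> x" if "h \<in> H" for h
    using that False car by (auto simp: subset_iff)
  ultimately show ?thesis by auto
qed

text \<open>The neighbours of \<open>x\<close> are the elements of its centralizer apart from the center and \<open>x\<close> itself.\<close>

lemma max_degree_le_two_iff:
  assumes "finite (carrier G)" "\<not> comm_group G"
  shows "max_degree (with_proj (commuting_graph G)) \<le> 2 \<longleftrightarrow>
    (\<forall>x \<in> carrier G - center G. card (centralizer G x) \<le> card (center G) + 3)"
proof -
  have fin: "finite (centralizer G x)" for x
    using assms(1) by (simp add: centralizer_def)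
  have degree: "out_degree (with_proj (commuting_graph G)) x + card (center G) + 1 =
      card (centralizer G x)" if x: "x \<in> carrier G - center G" for x
  proof -
    have "{y \<in> carrier G - center G. y \<noteq> x \<and> x \<otimes> y = y \<otimes> x} =
        centralizer G x - insert x (center G)"
      by (auto simp: centralizer_def)
    moreover have sub: "insert x (center G) \<subseteq> centralizer G x"
      using x in_centralizer_self center_subset_centralizer by auto
    moreover have "card (insert x (center G)) = card (center G) + 1"
      using x assms(1) by (simp add: center_def)
    moreover have "card (centralizer G x - insert x (center G)) =
        card (centralizer G x) - card (insert x (center G))"
      "card (insert x (center G)) \<le> card (centralizer G x)"
      using card_Diff_subset[OF finite_subset[OF sub fin] sub] card_mono[OF fin sub] by simp_all
    ultimately show ?thesis
      unfolding out_degree_commuting_graph[OF x] by simp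
  qed
  have "verts (with_proj (commuting_graph G)) = carrier G - center G"
    by (simp add: commuting_graph_def)
  moreover have "carrier G - center G \<noteq> {}"
    using verts_commuting_graph_nonempty[OF is_group assms(2)]
    by (simp add: commuting_graph_def)
  ultimately have "max_degree (with_proj (commuting_graph G)) \<le> 2 \<longleftrightarrow>
      (\<forall>x \<in> carrier G - center G. out_degree (with_proj (commuting_graph G)) x \<le> 2)"
    using assms(1) by (simp add: max_degree_def)
  also have "\<dots> \<longleftrightarrow> (\<forall>x \<in> carrier G - center G. card (centralizer G x) \<le> card (center G) + 3)"
  proof (intro ball_cong refl)
    fix x assume "x \<in> carrier G - center G"
    from degree[OF this] show "out_degree (with_proj (commuting_graph G)) x \<le> 2 \<longleftrightarrow>
        card (centralizer G x) \<le> card (center G) + 3"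
      by linarith
  qed
  finally show ?thesis .
qed

text \<open>Both inclusions in \<open>Z < C(x) < G\<close> are strict for a non-central \<open>x\<close>.\<close>

lemma card_centralizer_noncentral:
  assumes "finite (carrier G)" "x \<in> carrier G - center G"
  shows "2 * card (center G) \<le> card (centralizer G x)"
    and "2 * card (centralizer G x) \<le> order G"
    and "card (center G) dvd card (centralizer G x)"
    and "card (centralizer G x) dvd order G"
proof -
  have x: "x \<in> carrier G" "x \<notin> center G" using assms by auto
  have C: "subgroup (centralizer G x) G" by (rule subgroup_centralizer[OF x(1)])
  have Csub: "centralizer G x \<subseteq> carrier G" by (rule subgroup.subset[OF C])
  have fin: "finite (centralizer G x)" using Csub assms(1) finite_subset by blast
  have sub: "center G \<subseteq> centralizer G x" by (rule center_subset_centralizer[OF x(1)])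
  then have "center G \<subset> centralizer G x" using in_centralizer_self x by auto
  then show "2 * card (center G) \<le> card (centralizer G x)"
    by (intro card_proper_subgroup subgroup_center C fin)
  have "centralizer G x \<subset> carrier G" using Csub centralizer_eq_carrier_iff x by auto
  then show "2 * card (centralizer G x) \<le> order G"
    unfolding order_def by (intro card_proper_subgroup subgroup_self C assms)
  show "card (center G) dvd card (centralizer G x)"
    by (intro subgroup_card_dvd subgroup_center C sub)
  show "card (centralizer G x) dvd order G"
    unfolding order_def by (intro subgroup_card_dvd subgroup_self C Csub)
qed

end

lemma is_iso_of_mon:
  assumes "h \<in> mon G H" "card (carrier G) = card (carrier H)" "finite (carrier H)"
  shows "G \<cong> H"
proof -
  have h: "h \<in> hom G H" "inj_on h (carrier G)" using assms(1) by (auto simp: mon_def)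
  have "h ` carrier G = carrier H"
    using h assms(2,3) by (intro card_subset_eq) (auto simp: card_image hom_def)
  with h show ?thesis by (intro is_isoI) (simp add: iso_iff)
qed

section \<open>Orbits: counting and faithfulness\<close>

text \<open>The orbit-stabilizer theorem in the form of a class equation: the points whose stabilizer has
  order \<open>c\<close> form a union of orbits, and the stabilizer orders of the points of an orbit add up to
  the order of the group.\<close>

lemma (in group_action) order_dvd_card_stabilizer_class:
  assumes "finite (carrier G)" "finite E"
  shows "order G dvd c * card {x \<in> E. card (stabilizer G \<phi> x) = c}"
proof -
  let ?s = "\<lambda>x. card (stabilizer G \<phi> x)"
  have const: "?s y = ?s x" if x: "x \<in> E" and y: "y \<in> orbit G \<phi> x" for x y
  proof -
    have yE: "y \<in> E" using x y element_image by (auto simp: orbit_def)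
    have "orbit G \<phi> x \<inter> orbit G \<phi> y \<noteq> {}"
      using orbit_refl[OF yE] y by auto
    then have "orbit G \<phi> y = orbit G \<phi> x"
      using disjoint_union[of "orbit G \<phi> x" "orbit G \<phi> y"] x yE by (auto simp: orbits_def)
    then have "card (orbit G \<phi> x) * ?s y = card (orbit G \<phi> x) * ?s x"
      using orbit_stabilizer_theorem[OF x] orbit_stabilizer_theorem[OF yE] by simp
    moreover have "card (orbit G \<phi> x) \<noteq> 0"
      using orbit_refl[OF x] assms(1) by (auto simp: orbit_def)
    ultimately show ?thesis by simp
  qed
  have "c * card {x \<in> E. ?s x = c} = (\<Sum>x\<in>E. if ?s x = c then ?s x else 0)"
    using assms(2) by (simp add: sum.If_cases Int_def)
  also have "\<dots> = (\<Sum>orb \<in> orbits G E \<phi>. \<Sum>x\<in>orb. if ?s x = c then ?s x else 0)"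
    by (rule disjoint_sum[OF assms(2), symmetric])
  also have "order G dvd \<dots>"
  proof (rule dvd_sum)
    fix orb assume orb: "orb \<in> orbits G E \<phi>"
    then obtain x where x: "x \<in> E" "orb = orbit G \<phi> x" by (auto simp: orbits_def)
    show "order G dvd (\<Sum>x\<in>orb. if ?s x = c then ?s x else 0)"
    proof (cases "?s x = c")
      case True
      then have "(\<Sum>x\<in>orb. if ?s x = c then ?s x else 0) = (\<Sum>x\<in>orb. ?s x)"
        using const[OF x(1)] x(2) by (intro sum.cong) auto
      then show ?thesis using card_stablizer_sum[OF assms(1) orb] by simp
    next
      case False
      then have "(\<Sum>x\<in>orb. if ?s x = c then ?s x else 0) = 0"
        using const[OF x(1)] x(2) by (intro sum.neutral) auto
      then show ?thesis by simp
    qed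
  qed
  finally show ?thesis .
qed

text \<open>Numbering the points of an orbit turns the action on it into permutations of \<open>{1..n}\<close>.\<close>

lemma (in group_action) faithful_orbit_embeds:
  assumes x: "x \<in> E" and "finite (orbit G \<phi> x)"
    and faithful: "\<And>g. g \<in> carrier G \<Longrightarrow> \<forall>y \<in> orbit G \<phi> x. \<phi> g y = y \<Longrightarrow> g = \<one>"
  shows "mon G (sym_group (card (orbit G \<phi> x))) \<noteq> {}"
proof -
  interpret group G using group_hom group_hom.axioms(1) by auto
  define B where "B = orbit G \<phi> x"
  define n where "n = card B"
  have OE: "B \<subseteq> E" using x element_image by (auto simp: B_def orbit_def)
  have act: "\<phi> g y \<in> B" if "g \<in> carrier G" "y \<in> B" for g y
  proof -
    from that(2) obtain k where k: "k \<in> carrier G" "y = \<phi> k x"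
      by (auto simp: B_def orbit_def)
    then have "\<phi> g y = \<phi> (g \<otimes> k) x"
      using composition_rule[OF x that(1) k(1)] by simp
    moreover have "g \<otimes> k \<in> carrier G" using that(1) k(1) by blast
    ultimately show ?thesis unfolding B_def orbit_def by blast
  qed
  obtain e where e: "bij_betw e {1..n} B"
    using assms(2) ex_bij_betw_nat_finite_1 unfolding B_def n_def by blast
  define d where "d = inv_into {1..n} e"
  have eO: "e i \<in> B" if "i \<in> {1..n}" for i using e that by (auto simp: bij_betw_def)
  have d: "d y \<in> {1..n}" "e (d y) = y" if "y \<in> B" for y
    using e that unfolding d_def bij_betw_def by (auto simp: inv_into_into f_inv_into_f)
  have de: "d (e i) = i" if "i \<in> {1..n}" for i
    using e that unfolding d_def bij_betw_def by auto
  \<comment> \<open>\<open>e\<close> numbers the orbit and \<open>d\<close> is its inverse; as a permutation of all natural numbers, \<open>h g\<close> fixes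
    everything outside \<open>{1..n}\<close>.\<close>
  define h where "h g = (\<lambda>i. if i \<in> {1..n} then d (\<phi> g (e i)) else i)" for g
  have comp: "h (g \<otimes> g') = h g \<circ> h g'" if "g \<in> carrier G" "g' \<in> carrier G" for g g'
  proof
    fix i
    show "h (g \<otimes> g') i = (h g \<circ> h g') i"
    proof (cases "i \<in> {1..n}")
      case True
      then show ?thesis
        using that eO act d OE by (simp add: h_def composition_rule subset_iff del: atLeastAtMost_iff)
    qed (auto simp: h_def)
  qed
  have h_one: "h \<one> = id"
    using id_eq_one[symmetric] eO OE de by (auto simp: h_def fun_eq_iff subset_iff simp del: atLeastAtMost_iff)
  have perm: "h g permutes {1..n}" if "g \<in> carrier G" for g
  proof -
    have "bij (h g)"
      using comp[of g "inv g"] comp[of "inv g" g] h_one that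
      by (intro o_bij[of "h (inv g)"]) auto
    then show ?thesis unfolding permutes_def bij_iff by (auto simp: h_def)
  qed
  have "h \<in> hom G (sym_group n)"
    using perm comp by (auto simp: hom_def sym_group_def)
  moreover have "inj_on h (carrier G)"
  proof -
    interpret H: group_hom G "sym_group n" h
      using calculation sym_group_is_group is_group by (simp add: group_hom_def group_hom_axioms_def)
    have "g = \<one>" if "g \<in> carrier G" "h g = \<one>\<^bsub>sym_group n\<^esub>" for g
    proof (rule faithful[OF that(1)], fold B_def, intro ballI)
      fix y assume y: "y \<in> B"
      have "h g (d y) = d y" using that(2) by (simp add: sym_group_one)
      then have "d (\<phi> g y) = d y" using y d by (simp add: h_def del: atLeastAtMost_iff)
      then show "\<phi> g y = y" using d(2) act[OF that(1) y] y by metis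
    qed
    then show ?thesis
      by (intro H.inj_iff_trivial_ker[THEN iffD2]) (auto simp: kernel_def)
  qed
  ultimately show ?thesis unfolding n_def B_def mon_def by auto
qed

section \<open>Subgroups of index two in symmetric and alternating groups\<close>

text \<open>Every 3-cycle \<open>p\<close> is the square of the even permutation \<open>p\<^sup>2\<close>, because \<open>p\<^sup>4 = p\<close>, and the 3-cycles
  generate the alternating group.\<close>

lemma alt_group_subset_of_squares:
  assumes H: "subgroup H (sym_group n)"
    and squares: "\<And>p. p \<in> carrier (alt_group n) \<Longrightarrow> p \<circ> p \<in> H"
  shows "carrier (alt_group n) \<subseteq> H"
proof -
  interpret S: group "sym_group n" by (rule sym_group_is_group)
  have "three_cycles n \<subseteq> H"
  proof
    fix p assume p: "p \<in> three_cycles n"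
    then obtain cs where cs: "p = cycle_of_list cs" "cycle cs" "length cs = 3" by auto
    then obtain a b c where abc: "cs = [a, b, c]" using stupid_lemma by blast
    have "p \<circ> p \<in> H"
      using squares p three_cycles_incl by blast
    then have "(p \<circ> p) \<circ> (p \<circ> p) \<in> H"
      using subgroup.m_closed[OF H] by (simp add: sym_group_mult)
    moreover have "(p \<circ> p) \<circ> (p \<circ> p) = p"
      using cs(2) unfolding cs(1) abc by (auto simp: fun_eq_iff transpose_def)
    ultimately show "p \<in> H" by simp
  qed
  then have "generate (sym_group n) (three_cycles n) \<subseteq> H"
    using S.generate_subgroup_incl[OF _ H] by blast
  moreover have "generate (alt_group n) (three_cycles n) = generate (sym_group n) (three_cycles n)"
    using S.generate_consistent[OF three_cycles_incl alt_group_is_subgroup]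
    by (simp add: alt_group_def)
  ultimately show ?thesis
    using alt_group_carrier_as_three_cycles by simp
qed

lemma alt_group_no_index_two:
  assumes "n \<ge> 2" and H: "subgroup H (alt_group n)"
  shows "order (alt_group n) \<noteq> 2 * card H"
proof
  assume eq: "order (alt_group n) = 2 * card H"
  interpret A: group "alt_group n" by (rule alt_group_is_group)
  have pos: "order (alt_group n) > 0"
    using alt_group_card_carrier[OF assms(1)] by (auto simp: order_def intro!: Nat.gr0I)
  then have fin: "finite (carrier (alt_group n))" by (simp add: A.order_gt_0_iff_finite)
  have "subgroup H (sym_group n)"
    using group.incl_subgroup[OF sym_group_is_group alt_group_is_subgroup] H
    by (simp add: alt_group_def)
  moreover have "p \<circ> p \<in> H" if "p \<in> carrier (alt_group n)" for p
    using A.square_mem_index_two[OF H A.subgroup_self subgroup.subset[OF H] fin _ that] eq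
    by (simp add: order_def alt_group_mult)
  ultimately have "carrier (alt_group n) \<subseteq> H" by (rule alt_group_subset_of_squares)
  then have "order (alt_group n) \<le> card H"
    using subgroup.subset[OF H] by (simp add: order_def card_mono finite_subset[OF _ fin])
  with eq pos show False by simp
qed

lemma index_two_subgroup_sym_group:
  assumes "n \<ge> 2" and H: "subgroup H (sym_group n)" and "2 * card H = fact n"
  shows "H = carrier (alt_group n)"
proof -
  interpret S: group "sym_group n" by (rule sym_group_is_group)
  have fin: "finite (carrier (sym_group n))"
    using sym_group_card_carrier[of n] by (metis card.infinite fact_nonzero)
  have "carrier (alt_group n) \<subseteq> H"
  proof (rule alt_group_subset_of_squares[OF H])
    fix p assume "p \<in> carrier (alt_group n)"
    then have "p \<in> carrier (sym_group n)"
      by (simp add: alt_group_carrier sym_group_carrier)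
    then show "p \<circ> p \<in> H"
      using S.square_mem_index_two[OF H S.subgroup_self subgroup.subset[OF H] fin] assms(3)
      by (simp add: sym_group_card_carrier sym_group_mult)
  qed
  moreover have "card (carrier (alt_group n)) = card H"
    using alt_group_card_carrier[OF assms(1)] assms(3) by simp
  ultimately show ?thesis
    using finite_subset[OF subgroup.subset[OF H] fin] by (metis card_subset_eq)
qed

section \<open>Groups with trivial center\<close>

text \<open>The class equation of a group of order \<open>n\<close> with trivial center in which \<open>a\<close>, \<open>b\<close> and \<open>d\<close>
  elements have centralizers of order 2, 3 and 4, and all but the identity are of this kind.  The
  lower bounds on \<open>n\<close> express that these centralizers are proper subgroups.\<close>

lemma class_equation_solutions:
  fixes n a b d :: nat
  assumes "a \<noteq> 0 \<longrightarrow> 2 dvd n \<and> 4 \<le> n" "b \<noteq> 0 \<longrightarrow> 3 dvd n \<and> 6 \<le> n" "d \<noteq> 0 \<longrightarrow> 4 dvd n \<and> 8 \<le> n"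
    and "n = 1 + a + b + d" and "n dvd 2 * a" "n dvd 3 * b" "n dvd 4 * d"
    and "n = 2 \<or> n = 3 \<or> n = 4 \<or> n = 6 \<or> n = 12"
  shows "(n = 6 \<and> a \<noteq> 0) \<or> (n = 12 \<and> b \<noteq> 0)"
  using assms(8)
proof (elim disjE)
  assume n: "n = 2" show ?thesis using assms(1-7)[unfolded n] by presburger
next
  assume n: "n = 3" show ?thesis using assms(1-7)[unfolded n] by presburger
next
  assume n: "n = 4" show ?thesis using assms(1-7) unfolding n by simp
next
  assume n: "n = 6" show ?thesis using assms(1-7) unfolding n by simp presburger
next
  assume n: "n = 12" show ?thesis using assms(1-7) unfolding n by simp presburger
qed

context group
begin

lemma order_dvd_card_centralizer_class:
  assumes "finite (carrier G)"
  shows "order G dvd c * card {x \<in> carrier G - center G. card (centralizer G x) = c}"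
proof (cases "c = order G")
  case False
  have "card (centralizer G x) = order G" if "x \<in> center G" for x
  proof -
    have "x \<in> carrier G" using that by (simp add: center_def)
    then show ?thesis using centralizer_eq_carrier_iff[of x] that by (simp add: order_def)
  qed
  then have "{x \<in> carrier G - center G. card (centralizer G x) = c} =
      {x \<in> carrier G. card (stabilizer G conj_action x) = c}"
    using False by (auto simp: stabilizer_conj_action)
  then show ?thesis
    using group_action.order_dvd_card_stabilizer_class[OF action_by_conjugation assms assms] by simp
qed simp

text \<open>Dividing \<open>n = 1 + a + b + d\<close> by \<open>n\<close> expresses \<open>1 - 1 / n\<close> as a sum of terms \<open>1 / 2\<close>, \<open>1 / 3\<close> and
  \<open>1 / 4\<close>, one for each conjugacy class other than that of the identity.  Hence \<open>n\<close> divides 12,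
  and finitely many cases remain.\<close>

lemma order_six_or_twelve_if_small_centralizers:
  assumes fin: "finite (carrier G)" and "\<not> comm_group G" and Z: "card (center G) = 1"
    and small: "\<forall>x \<in> carrier G - center G. card (centralizer G x) \<le> 4"
  shows "(order G = 6 \<and> (\<exists>x \<in> carrier G - center G. card (centralizer G x) = 2)) \<or>
    (order G = 12 \<and> (\<exists>x \<in> carrier G - center G. card (centralizer G x) = 3))"
proof -
  define n where "n = order G"
  define K where "K c = {x \<in> carrier G - center G. card (centralizer G x) = c}" for c
  have finK: "finite (K c)" for c using fin by (simp add: K_def)
  have dvd: "n dvd c * card (K c)" for c
    unfolding n_def K_def by (rule order_dvd_card_centralizer_class[OF fin])
  have witness: "\<exists>x \<in> carrier G - center G. card (centralizer G x) = c" if "card (K c) \<noteq> 0" for c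
  proof -
    have "K c \<noteq> {}" using that by auto
    then show ?thesis by (auto simp: K_def)
  qed
  have nonempty: "c dvd n \<and> 2 * c \<le> n" if "card (K c) \<noteq> 0" for c
  proof -
    obtain x where "x \<in> carrier G - center G" "card (centralizer G x) = c"
      using witness \<open>card (K c) \<noteq> 0\<close> by blast
    then show ?thesis
      using card_centralizer_noncentral(2,4)[OF fin, of x] by (simp add: n_def)
  qed
  have "carrier G - center G = K 2 \<union> K 3 \<union> K 4"
  proof -
    have "card (centralizer G x) \<in> {2, 3, 4}" if "x \<in> carrier G - center G" for x
    proof -
      have "2 \<le> card (centralizer G x)" "card (centralizer G x) \<le> 4"
        using card_centralizer_noncentral(1)[OF fin that] Z small that by auto
      then show ?thesis by auto
    qed
    then show ?thesis by (auto simp: K_def)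
  qed
  moreover have "card (K 2 \<union> K 3 \<union> K 4) = card (K 2) + card (K 3) + card (K 4)"
  proof -
    have "K 2 \<inter> K 3 = {}" "(K 2 \<union> K 3) \<inter> K 4 = {}" by (auto simp: K_def)
    then show ?thesis using finK by (simp add: card_Un_disjoint)
  qed
  moreover have "card (carrier G - center G) = n - 1"
    using Z fin by (simp add: n_def order_def card_Diff_subset finite_subset[OF _ fin]
        subgroup.subset[OF subgroup_center])
  moreover have "n \<noteq> 0" using fin by (auto simp: n_def order_def)
  ultimately have n: "n = 1 + card (K 2) + card (K 3) + card (K 4)" by simp
  obtain a b d where abd: "a = card (K 2)" "b = card (K 3)" "d = card (K 4)" by blast
  have "carrier G - center G \<noteq> {}"
    using verts_commuting_graph_nonempty[OF is_group assms(2)]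
    by (simp add: commuting_graph_def)
  then have "n \<noteq> 1"
    using \<open>card (carrier G - center G) = n - 1\<close> fin by auto
  have "n dvd 2 * a" "n dvd 3 * b" "n dvd 4 * d"
    using dvd[of 2] dvd[of 3] dvd[of 4] by (simp_all add: abd)
  have "n dvd 6 * (2 * a) + 4 * (3 * b) + 3 * (4 * d)"
    by (rule dvd_add[OF dvd_add[OF dvd_mult[OF \<open>n dvd 2 * a\<close>] dvd_mult[OF \<open>n dvd 3 * b\<close>]]
          dvd_mult[OF \<open>n dvd 4 * d\<close>]])
  moreover have "12 * n = 12 + (6 * (2 * a) + 4 * (3 * b) + 3 * (4 * d))"
    using n by (simp add: abd)
  ultimately have "n dvd 12" 
    using dvd_add_left_iff[of n _ 12] dvd_triv_right[of n 12] by simp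
  then have "n \<le> 12" by (simp add: dvd_imp_le)
  have "a \<noteq> 0 \<longrightarrow> 2 dvd n \<and> 4 \<le> n" "b \<noteq> 0 \<longrightarrow> 3 dvd n \<and> 6 \<le> n" "d \<noteq> 0 \<longrightarrow> 4 dvd n \<and> 8 \<le> n"
    using nonempty[of 2] nonempty[of 3] nonempty[of 4] by (auto simp: abd)
  moreover have "n = 1 + a + b + d" using n by (simp add: abd)
  moreover have "n = 2 \<or> n = 3 \<or> n = 4 \<or> n = 6 \<or> n = 12"
  proof -
    have "n = 0 \<or> n = 1 \<or> n = 2 \<or> n = 3 \<or> n = 4 \<or> n = 5 \<or> n = 6 \<or> n = 7 \<or> n = 8 \<or> n = 9 \<or>
        n = 10 \<or> n = 11 \<or> n = 12"
      using \<open>n \<le> 12\<close> by presburger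
    then show ?thesis
      using \<open>n dvd 12\<close> \<open>n \<noteq> 1\<close> by (elim disjE) simp_all
  qed
  ultimately have "(n = 6 \<and> a \<noteq> 0) \<or> (n = 12 \<and> b \<noteq> 0)"
    using \<open>n dvd 2 * a\<close> \<open>n dvd 3 * b\<close> \<open>n dvd 4 * d\<close> class_equation_solutions[of a n b d] by blast
  then show ?thesis
    using witness[of 2] witness[of 3] unfolding abd n_def by blast
qed

text \<open>The group acts by conjugation on the class of \<open>x\<close>, which has \<open>m\<close> elements.  An element acting
  trivially centralizes this class and also the identity, that is, at least \<open>m + 1\<close> elements.\<close>

lemma mon_sym_group_if_small_centralizers:
  assumes fin: "finite (carrier G)" and x: "x \<in> carrier G" "x \<noteq> \<one>"
    and "card (centralizer G x) * m = order G"
    and small: "\<And>g. g \<in> carrier G \<Longrightarrow> g \<noteq> \<one> \<Longrightarrow> card (centralizer G g) \<le> m"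
  shows "mon G (sym_group m) \<noteq> {}"
proof -
  interpret C: group_action G "carrier G" conj_action by (rule action_by_conjugation)
  let ?O = "orbit G conj_action x"
  have sub: "?O \<subseteq> carrier G" 
    using C.element_image[OF _ x(1)] unfolding orbit_def by blast
  have finO: "finite ?O" using sub fin finite_subset by blast
  have "card ?O * card (centralizer G x) = card (centralizer G x) * m"
    using C.orbit_stabilizer_theorem[OF x(1)] assms(4) by (simp add: stabilizer_conj_action x)
  moreover have "card (centralizer G x) \<noteq> 0"
    using in_centralizer_self[OF x(1)] fin by (auto simp: card_eq_0_iff centralizer_def)
  ultimately have card: "card ?O = m" by simp
  have one: "\<one> \<notin> ?O"
  proof
    assume "\<one> \<in> ?O"
    then obtain g where g: "g \<in> carrier G" "g \<otimes> x \<otimes> inv g = \<one>"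
      using x(1) by (auto simp: orbit_def)
    then show False using conjugation_is_inj[of g x \<one>] x by simp
  qed
  have "mon G (sym_group (card ?O)) \<noteq> {}"
  proof (rule C.faithful_orbit_embeds[OF x(1) finO], rule ccontr)
    fix g assume g: "g \<in> carrier G" "\<forall>y \<in> ?O. conj_action g y = y" "g \<noteq> \<one>"
    then have "insert \<one> ?O \<subseteq> centralizer G g"
      using sub by (auto simp: centralizer_def conj_eq_iff subset_iff)
    then have "card (insert \<one> ?O) \<le> card (centralizer G g)"
      using fin by (intro card_mono) (auto simp: centralizer_def)
    with small[OF g(1,3)] show False using one finO card by simp
  qed
  with card show ?thesis by simp
qed

text \<open>In order 6 a centralizer of order 2 belongs to a class of size 3; in order 12 a centralizer of
  order 3 belongs to a class of size 4.  These classes are large enough for conjugation on them to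
  be faithful.\<close>

lemma trivial_center_classification:
  assumes fin: "finite (carrier G)" and nc: "\<not> comm_group G" and Z: "card (center G) = 1"
    and small: "\<forall>x \<in> carrier G - center G. card (centralizer G x) \<le> 4"
  shows "G \<cong> sym_group 3 \<or> G \<cong> alt_group 4"
proof -
  have center: "center G = {\<one>}"
    using Z subgroup.one_closed[OF subgroup_center] by (auto simp: card_1_singleton_iff)
  from order_six_or_twelve_if_small_centralizers[OF assms] show ?thesis
  proof (elim disjE conjE bexE)
    fix x assume n: "order G = 6" and x: "x \<in> carrier G - center G" "card (centralizer G x) = 2"
    have "card (centralizer G g) \<le> 3" if "g \<in> carrier G" "g \<noteq> \<one>" for g
      using card_centralizer_noncentral(2)[OF fin, of g] that n center by simp
    then have "mon G (sym_group 3) \<noteq> {}"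
      using x n center by (intro mon_sym_group_if_small_centralizers[OF fin, of x]) auto
    then obtain h where "h \<in> mon G (sym_group 3)" by blast
    moreover have "card (carrier G) = card (carrier (sym_group 3))"
      using n by (simp add: order_def sym_group_card_carrier fact_numeral)
    moreover have "finite (carrier (sym_group 3))"
      using sym_group_card_carrier[of 3] by (metis card.infinite fact_nonzero)
    ultimately show ?thesis using is_iso_of_mon by blast
  next
    fix x assume n: "order G = 12" and x: "x \<in> carrier G - center G" "card (centralizer G x) = 3"
    have "mon G (sym_group 4) \<noteq> {}"
      using x n center small by (intro mon_sym_group_if_small_centralizers[OF fin, of x]) auto
    then obtain h where h: "h \<in> hom G (sym_group 4)" "inj_on h (carrier G)"
      by (auto simp: mon_def)
    then interpret h: group_hom G "sym_group 4" h
      by (simp add: group_hom_def group_hom_axioms_def sym_group_is_group)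
    have "card (h ` carrier G) = 12" using h(2) n by (simp add: card_image order_def)
    then have "h ` carrier G = carrier (alt_group 4)"
      using h.img_is_subgroup by (intro index_two_subgroup_sym_group) (simp_all add: fact_numeral)
    then have "h \<in> iso G (alt_group 4)"
      using h by (auto simp: iso_iff hom_def alt_group_def)
    then show ?thesis by (auto intro: is_isoI)
  qed
qed

end

section \<open>Non-abelian groups of order eight\<close>

context group
begin

text \<open>Conjugation by the involution \<open>f\<close> is an endomorphism, so it inverts all powers of \<open>r\<close> as soon as
  it inverts \<open>r\<close>.\<close>

lemma dihedral_int_pow_swap:
  assumes r: "r \<in> carrier G" and f: "f \<in> carrier G" and ff: "f \<otimes> f = \<one>"
    and frf: "f \<otimes> r \<otimes> f = inv r"
  shows "f \<otimes> r [^] (j :: int) = r [^] (- j) \<otimes> f"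
proof -
  have inv_f: "inv f = f" using f ff by (simp add: inv_equality)
  interpret c: group_hom G G "\<lambda>h. f \<otimes> h \<otimes> f"
  proof (unfold_locales, rule homI)
    fix a b assume "a \<in> carrier G" "b \<in> carrier G"
    then show "f \<otimes> (a \<otimes> b) \<otimes> f = f \<otimes> a \<otimes> f \<otimes> (f \<otimes> b \<otimes> f)"
      using f ff by (metis m_assoc m_closed r_one)
  qed (use f in auto)
  have "f \<otimes> r [^] j \<otimes> f = inv r [^] j"
    using c.hom_int_pow[OF r, of j] by (simp add: frf)
  also have "\<dots> = r [^] (- j)" using r by (simp add: int_pow_inv int_pow_neg)
  finally have "f \<otimes> r [^] j \<otimes> inv f = r [^] (- j)" by (simp add: inv_f)
  then show ?thesis using r f by (simp add: conj_eq_iff)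
qed

text \<open>The defining relations make \<open>r\<^sup>i f\<^sup>s\<close> multiply like the pair \<open>(i, s)\<close>; the kernel is trivial
  because \<open>f\<close> is not a power of \<open>r\<close>, and the orders agree.\<close>

lemma is_iso_dihedral_group:
  assumes r: "r \<in> carrier G" and f: "f \<in> carrier G" and ff: "f \<otimes> f = \<one>"
    and frf: "f \<otimes> r \<otimes> f = inv r" and "ord r = n" "n > 0"
    and f_not_pow: "\<And>k :: int. f \<noteq> r [^] k" and order: "order G = 2 * n"
  shows "G \<cong> dihedral_group n"
proof -
  let ?D = "dihedral_group n"
  define h where "h = (\<lambda>(i :: int, s). r [^] i \<otimes> (if s then f else \<one>))"
  have pow_mod: "r [^] (k mod int n) = r [^] k" for k :: int
    using int_pow_eq[OF r, of "k mod int n" k] assms(5) by (simp add: minus_mod_eq_mult_div)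
  have swap: "f \<otimes> r [^] j = r [^] (- j) \<otimes> f" for j :: int
    by (rule dihedral_int_pow_swap[OF r f ff frf])
  have car: "r [^] k \<in> carrier G" for k :: int using r by simp
  have hom: "h \<in> hom ?D G"
  proof (rule homI)
    fix a b assume "a \<in> carrier ?D" "b \<in> carrier ?D"
    obtain i s j t where ab: "a = (i, s)" "b = (j, t)" by (cases a, cases b)
    show "h (a \<otimes>\<^bsub>?D\<^esub> b) = h a \<otimes> h b"
    proof (cases s)
      case False
      then show ?thesis
        using r f by (simp add: ab h_def dihedral_group_def pow_mod int_pow_mult m_assoc)
    next
      case True
      have "r [^] i \<otimes> f \<otimes> (r [^] j \<otimes> u) = r [^] (i - j) \<otimes> (f \<otimes> u)" if "u \<in> carrier G" for u
      proof -
        have "r [^] i \<otimes> f \<otimes> (r [^] j \<otimes> u) = r [^] i \<otimes> (f \<otimes> r [^] j) \<otimes> u"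
          using car f that by (simp add: m_assoc)
        also have "\<dots> = r [^] i \<otimes> r [^] (- j) \<otimes> (f \<otimes> u)"
          unfolding swap using car f that by (simp add: m_assoc)
        also have "r [^] i \<otimes> r [^] (- j) = r [^] (i - j)"
          using int_pow_mult[OF r, of i "- j"] by simp
        finally show ?thesis .
      qed
      from this[of "if t then f else \<one>"] show ?thesis
        using True f ff by (simp add: ab h_def dihedral_group_def pow_mod)
    qed
  qed (use r f in \<open>auto simp: h_def\<close>)
  interpret h: group_hom ?D G h
    using hom group_dihedral_group[OF \<open>n > 0\<close>]
    by (simp add: group_hom_def group_hom_axioms_def is_group)
  have "a = \<one>\<^bsub>?D\<^esub>" if "a \<in> carrier ?D" "h a = \<one>" for a
  proof -
    obtain i s where a: "a = (i, s)" by (cases a)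
    have i: "0 \<le> i" "i < int n" using that(1) by (auto simp: a dihedral_group_def)
    have "\<not> s"
    proof
      assume s
      then have "r [^] i \<otimes> f = \<one>" using that(2) by (simp add: a h_def)
      then have "f = inv (r [^] i)" using r f by (metis car inv_inv inv_equality)
      then have "f = r [^] (- i)" using r by (simp add: int_pow_neg)
      with f_not_pow show False by blast
    qed
    with that(2) r have "r [^] i = \<one>" by (simp add: a h_def)
    then have "int n dvd i" using int_pow_eq_id[OF r, of i] assms(5) by simp
    then have "i = 0" using zdvd_not_zless[of i "int n"] i by linarith
    with \<open>\<not> s\<close> show ?thesis by (simp add: a dihedral_group_def)
  qed
  then have "inj_on h (carrier ?D)"
    by (intro h.inj_iff_trivial_ker[THEN iffD2]) (auto simp: kernel_def)
  with hom have "h \<in> mon ?D G" by (simp add: mon_def)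
  moreover have "card (carrier ?D) = card (carrier G)"
    using order order_dihedral_group[of n] by (simp add: order_def)
  moreover have "finite (carrier G)"
    using order \<open>n > 0\<close> by (intro order_gt_0_iff_finite[THEN iffD1]) simp
  ultimately have "?D \<cong> G" by (rule is_iso_of_mon)
  then show ?thesis by (rule h.G.iso_sym)
qed

text \<open>The isomorphism sends \<open>-1\<close>, \<open>i\<close>, \<open>j\<close>, \<open>k\<close> to \<open>z\<close>, \<open>x\<close>, \<open>y\<close>, \<open>x y\<close>.  The relations bring every
  product into the normal form \<open>z\<^sup>e x\<^sup>s y\<^sup>t\<close>, and none of the seven other images is the identity since
  \<open>z \<noteq> \<one>\<close> and since \<open>x\<close>, \<open>y\<close> and \<open>x y\<close> are not central.\<close>

lemma is_iso_quaternion_group: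
  assumes x: "x \<in> carrier G" and y: "y \<in> carrier G" and z: "z \<in> center G" "z \<noteq> \<one>"
    and xx: "x \<otimes> x = z" and yy: "y \<otimes> y = z" and zz: "z \<otimes> z = \<one>"
    and yx: "y \<otimes> x = z \<otimes> (x \<otimes> y)" and order: "order G = 8"
  shows "G \<cong> quaternion_group"
proof -
  let ?Q = "quaternion_group"
  have zc: "z \<in> carrier G" and z_comm: "\<And>g. g \<in> carrier G \<Longrightarrow> g \<otimes> z = z \<otimes> g"
    using z by (simp_all add: center_def)
  \<comment> \<open>Exactly one coordinate of an element of the group is non-zero, and it is 1 or -1: the sum of the
    coordinates is the sign, and the position of the non-zero one selects the factor.\<close>
  define h where "h = (\<lambda>(a :: int, b :: int, c :: int, d :: int).
      (if a + b + c + d = 1 then \<one> else z) \<otimes>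
      (if b \<noteq> 0 then x else if c \<noteq> 0 then y else if d \<noteq> 0 then x \<otimes> y else \<one>))"
  have left: "z \<otimes> (z \<otimes> g) = g" "x \<otimes> (x \<otimes> g) = z \<otimes> g" "y \<otimes> (y \<otimes> g) = z \<otimes> g"
    "y \<otimes> (x \<otimes> g) = z \<otimes> (x \<otimes> (y \<otimes> g))" "x \<otimes> (z \<otimes> g) = z \<otimes> (x \<otimes> g)"
    "y \<otimes> (z \<otimes> g) = z \<otimes> (y \<otimes> g)" if "g \<in> carrier G" for g
  proof -
    have extend: "u \<otimes> (v \<otimes> g) = w \<otimes> g"
      if "u \<otimes> v = w" "u \<in> carrier G" "v \<in> carrier G" for u v w
      using m_assoc[of u v g] that \<open>g \<in> carrier G\<close> by simp
    show "z \<otimes> (z \<otimes> g) = g" "x \<otimes> (x \<otimes> g) = z \<otimes> g" "y \<otimes> (y \<otimes> g) = z \<otimes> g"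
      "y \<otimes> (x \<otimes> g) = z \<otimes> (x \<otimes> (y \<otimes> g))" "x \<otimes> (z \<otimes> g) = z \<otimes> (x \<otimes> g)"
      "y \<otimes> (z \<otimes> g) = z \<otimes> (y \<otimes> g)"
      using extend[OF zz zc zc] extend[OF xx x x] extend[OF yy y y] extend[OF yx y x]
        extend[OF z_comm[OF x] x zc] extend[OF z_comm[OF y] y zc] that x y zc
      by (simp_all add: m_assoc)
  qed
  have h_values: "h (1, 0, 0, 0) = \<one>" "h (-1, 0, 0, 0) = z" "h (0, 1, 0, 0) = x"
    "h (0, -1, 0, 0) = z \<otimes> x" "h (0, 0, 1, 0) = y" "h (0, 0, -1, 0) = z \<otimes> y"
    "h (0, 0, 0, 1) = x \<otimes> y" "h (0, 0, 0, -1) = z \<otimes> (x \<otimes> y)"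
    using x y zc by (simp_all add: h_def)
  have hom: "h \<in> hom ?Q G"
  proof (rule homI)
    fix a assume "a \<in> carrier ?Q"
    then show "h a \<in> carrier G" using x y zc by (auto simp: quaternion_group_def h_values)
  next
    fix a b assume "a \<in> carrier ?Q" "b \<in> carrier ?Q"
    then show "h (a \<otimes>\<^bsub>?Q\<^esub> b) = h a \<otimes> h b"
      using x y zc xx yy zz yx z_comm[OF x] z_comm[OF y]
      by (simp add: quaternion_group_def) (elim disjE; simp add: h_values m_assoc left)
  qed
  interpret h: group_hom ?Q G h
    using hom group_quaternion_group
    by (simp add: group_hom_def group_hom_axioms_def is_group)
  have xy_neq: "x \<otimes> y \<noteq> y \<otimes> x"
  proof
    assume "x \<otimes> y = y \<otimes> x"
    then have "\<one> \<otimes> (x \<otimes> y) = z \<otimes> (x \<otimes> y)" using yx x y by simp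
    then show False
      using right_cancel[of "x \<otimes> y" \<one> z] z(2) zc x y by simp
  qed
  have not_comm: "g \<noteq> \<one> \<and> z \<otimes> g \<noteq> \<one>"
    if g: "g \<otimes> k \<noteq> k \<otimes> g" "g \<in> carrier G" "k \<in> carrier G" for g k
  proof (intro conjI notI)
    assume "g = \<one>"
    with g show False by simp
  next
    assume "z \<otimes> g = \<one>"
    then have "g = z" using left(1)[OF g(2)] zc by simp
    with g z_comm show False by simp
  qed
  have "x \<otimes> (x \<otimes> y) \<noteq> x \<otimes> y \<otimes> x"
    using xy_neq x y by (simp add: m_assoc)
  then have "x \<otimes> y \<noteq> \<one> \<and> z \<otimes> (x \<otimes> y) \<noteq> \<one>"
    using x y by (intro not_comm[of _ x]) auto
  moreover have "x \<noteq> \<one> \<and> z \<otimes> x \<noteq> \<one>" "y \<noteq> \<one> \<and> z \<otimes> y \<noteq> \<one>"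
    using not_comm[OF xy_neq x y] not_comm[OF xy_neq[symmetric] y x] by simp_all
  ultimately have "a = \<one>\<^bsub>?Q\<^esub>" if "a \<in> carrier ?Q" "h a = \<one>" for a
    using that x y zc z(2) by (auto simp: quaternion_group_def h_values)
  then have "inj_on h (carrier ?Q)"
    by (intro h.inj_iff_trivial_ker[THEN iffD2]) (auto simp: kernel_def)
  with hom have "h \<in> mon ?Q G" by (simp add: mon_def)
  moreover have "card (carrier ?Q) = card (carrier G)"
    using order order_quaternion_group by (simp add: order_def)
  moreover have "finite (carrier G)"
    using order by (intro order_gt_0_iff_finite[THEN iffD1]) simp
  ultimately have "?Q \<cong> G" by (rule is_iso_of_mon)
  then show ?thesis by (rule h.G.iso_sym)
qed

text \<open>If both \<open>x\<close> and \<open>y\<close> have square \<open>z\<close>, they behave like \<open>i\<close> and \<open>j\<close>.  Otherwise one of \<open>x\<close>, \<open>y\<close>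
  is an involution and one of \<open>x\<close>, \<open>y\<close>, \<open>x y\<close> has order four, and these serve as reflection and
  rotation.\<close>

lemma order_eight_classification:
  assumes z: "z \<in> center G" "z \<noteq> \<one>" "z \<otimes> z = \<one>" and order: "order G = 8"
    and squares: "\<And>g. g \<in> carrier G \<Longrightarrow> g \<otimes> g \<in> {\<one>, z}"
    and x: "x \<in> carrier G" and y: "y \<in> carrier G" and yx: "y \<otimes> x = z \<otimes> (x \<otimes> y)"
  shows "G \<cong> dihedral_group 4 \<or> G \<cong> quaternion_group"
proof -
  have zc: "z \<in> carrier G" and z_comm: "\<And>g. g \<in> carrier G \<Longrightarrow> g \<otimes> z = z \<otimes> g"
    using z(1) by (simp_all add: center_def)
  have dihedral: "G \<cong> dihedral_group 4"
    if r: "r \<in> carrier G" "r \<otimes> r = z" and f: "f \<in> carrier G" "f \<otimes> f = \<one>"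
      and fr: "f \<otimes> r = z \<otimes> (r \<otimes> f)" for r f
  proof (rule is_iso_dihedral_group[OF r(1) f])
    have "f \<otimes> r \<otimes> f = z \<otimes> r"
      using r f zc by (simp add: fr m_assoc)
    also have "z \<otimes> r = inv r"
      using r zc z by (intro inv_equality[symmetric]) (simp_all add: m_assoc)
    finally show "f \<otimes> r \<otimes> f = inv r" .
    have r2: "r [^] (2 :: nat) = z" using r by (simp add: numeral_2_eq_2)
    have "r [^] (4 :: nat) = r [^] (2 :: nat) \<otimes> r [^] (2 :: nat)"
      using r(1) by (simp add: nat_pow_mult)
    then have "ord r dvd 4" using r2 z(3) r(1) by (simp add: pow_eq_id)
    moreover have "\<not> ord r dvd 2" using r2 z(2) r(1) by (simp flip: pow_eq_id)
    moreover have "ord r \<le> 4" using calculation(1) by (simp add: dvd_imp_le)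
    then have "ord r = 0 \<or> ord r = 1 \<or> ord r = 2 \<or> ord r = 3 \<or> ord r = 4" by presburger
    ultimately show "ord r = 4" by (elim disjE) simp_all
    fix k :: int
    show "f \<noteq> r [^] k"
    proof
      assume "f = r [^] k"
      then have "f \<otimes> r = r \<otimes> f"
        using r(1) int_pow_mult[of r k 1] int_pow_mult[of r 1 k] by (simp add: add.commute)
      then have "z \<otimes> (r \<otimes> f) = \<one> \<otimes> (r \<otimes> f)" using fr r f by simp
      then show False using right_cancel[of "r \<otimes> f" \<one> z] z(2) zc r f by simp
    qed
  qed (simp_all add: order)
  have xz: "x \<otimes> z = z \<otimes> x" and yz: "y \<otimes> z = z \<otimes> y" using z_comm x y by auto
  have xy: "x \<otimes> y = z \<otimes> (y \<otimes> x)"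
    using yx x y zc z(3) by (simp flip: m_assoc)
  show ?thesis
  proof (cases "x \<otimes> x = z")
    case xx: True
    show ?thesis
    proof (cases "y \<otimes> y = z")
      case True
      then show ?thesis using is_iso_quaternion_group[OF x y z(1,2) xx _ z(3) yx order] by simp
    next
      case False
      then have "y \<otimes> y = \<one>" using squares[OF y] by simp
      with dihedral[of x y] xx x y yx show ?thesis by simp
    qed
  next
    case False
    then have xx: "x \<otimes> x = \<one>" using squares[OF x] by simp
    show ?thesis
    proof (cases "y \<otimes> y = z")
      case True
      with dihedral[of y x] xx x y xy show ?thesis by simp
    next
      case False
      then have yy: "y \<otimes> y = \<one>" using squares[OF y] by simp
      have "x \<otimes> y \<otimes> (x \<otimes> y) = x \<otimes> (y \<otimes> x) \<otimes> y"
        using x y by (simp add: m_assoc)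
      also have "\<dots> = z \<otimes> ((x \<otimes> x) \<otimes> (y \<otimes> y))"
        using x y zc by (simp add: yx m_assoc) (simp add: xz flip: m_assoc)
      finally have "x \<otimes> y \<otimes> (x \<otimes> y) = z" using xx yy zc by simp
      moreover have "x \<otimes> (x \<otimes> y) = z \<otimes> (x \<otimes> y \<otimes> x)"
      proof -
        have "z \<otimes> (x \<otimes> y \<otimes> x) = x \<otimes> (z \<otimes> (y \<otimes> x))"
          using x y zc by (simp add: m_assoc) (simp add: xz flip: m_assoc)
        then show ?thesis using xy by simp
      qed
      ultimately show ?thesis using dihedral[of "x \<otimes> y" x] xx x y by simp
    qed
  qed
qed

end

section \<open>Groups with non-trivial center\<close>

context group
begin

text \<open>The quotient by the center has exponent two and is therefore abelian, so commutators are
  central.  Since \<open>y x = c (x y)\<close> implies \<open>y x\<^sup>2 = c\<^sup>2 x\<^sup>2 y\<close>, and \<open>x\<^sup>2\<close> is central, \<open>c\<^sup>2 = 1\<close>.\<close>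

lemma commutator_of_central_squares:
  assumes squares: "\<And>g. g \<in> carrier G \<Longrightarrow> g \<otimes> g \<in> center G"
    and x: "x \<in> carrier G" and y: "y \<in> carrier G"
  obtains c where "c \<in> center G" "c \<otimes> c = \<one>" "y \<otimes> x = c \<otimes> (x \<otimes> y)"
proof -
  have central: "z \<in> carrier G" "g \<otimes> z = z \<otimes> g" if "z \<in> center G" "g \<in> carrier G" for z g
    using that by (simp_all add: center_def)
  define w where "w = x \<otimes> x \<otimes> (y \<otimes> y)"
  \<comment> \<open>This is the commutator \<open>y x (x y)\<inverse>\<close>, written as a product of squares and inverses of squares
    to make it visibly central; it uses \<open>(y x) (x y) = w\<close>.\<close>
  define c where "c = y \<otimes> x \<otimes> (y \<otimes> x) \<otimes> inv w"
  have w: "w \<in> center G"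
    unfolding w_def by (rule subgroup.m_closed[OF subgroup_center squares[OF x] squares[OF y]])
  have c: "c \<in> center G"
    unfolding c_def
    by (rule subgroup.m_closed[OF subgroup_center squares[OF m_closed[OF y x]]
          subgroup.m_inv_closed[OF subgroup_center w]])
  have wc: "w \<in> carrier G" and cc: "c \<in> carrier G" using central(1)[OF _ x] w c by auto
  have inv_w: "g \<otimes> inv w = inv w \<otimes> g" if "g \<in> carrier G" for g
    using central(2)[OF subgroup.m_inv_closed[OF subgroup_center w] that] .
  have xy_yx: "y \<otimes> x \<otimes> (x \<otimes> y) = w"
  proof -
    have "y \<otimes> x \<otimes> (x \<otimes> y) = y \<otimes> (x \<otimes> x) \<otimes> y" using x y by (simp add: m_assoc)
    also have "y \<otimes> (x \<otimes> x) = x \<otimes> x \<otimes> y" by (rule central(2)[OF squares[OF x] y])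
    finally show ?thesis using x y by (simp add: w_def m_assoc)
  qed
  have "c \<otimes> (x \<otimes> y) = y \<otimes> x \<otimes> (y \<otimes> x) \<otimes> (inv w \<otimes> (x \<otimes> y))"
    unfolding c_def using x y wc by (simp add: m_assoc)
  also have "inv w \<otimes> (x \<otimes> y) = x \<otimes> y \<otimes> inv w" using inv_w[of "x \<otimes> y"] x y by simp
  also have "y \<otimes> x \<otimes> (y \<otimes> x) \<otimes> (x \<otimes> y \<otimes> inv w) = y \<otimes> x \<otimes> (y \<otimes> x \<otimes> (x \<otimes> y)) \<otimes> inv w"
    using x y wc by (simp add: m_assoc)
  also have "\<dots> = y \<otimes> x" unfolding xy_yx using x y wc by (simp add: m_assoc)
  finally have yx: "y \<otimes> x = c \<otimes> (x \<otimes> y)" by simp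
  have xc: "x \<otimes> (c \<otimes> g) = c \<otimes> (x \<otimes> g)" if "g \<in> carrier G" for g
    using central(2)[OF c x] m_assoc[of x c g] m_assoc[of c x g] x cc that by simp
  have "x \<otimes> x \<otimes> y = y \<otimes> (x \<otimes> x)" using central(2)[OF squares[OF x] y] by simp
  also have "\<dots> = y \<otimes> x \<otimes> x" using x y by (simp add: m_assoc)
  also have "\<dots> = c \<otimes> (x \<otimes> y) \<otimes> x" by (simp only: yx)
  also have "\<dots> = c \<otimes> (x \<otimes> (y \<otimes> x))" using x y cc by (simp add: m_assoc)
  also have "\<dots> = c \<otimes> (x \<otimes> (c \<otimes> (x \<otimes> y)))" by (simp only: yx)
  also have "\<dots> = c \<otimes> c \<otimes> (x \<otimes> x \<otimes> y)" using x y cc by (simp add: m_assoc xc)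
  finally have "\<one> \<otimes> (x \<otimes> x \<otimes> y) = c \<otimes> c \<otimes> (x \<otimes> x \<otimes> y)" using x y by simp
  then have "c \<otimes> c = \<one>" using right_cancel[of "x \<otimes> x \<otimes> y" \<one> "c \<otimes> c"] x y cc by simp
  with c yx that show thesis by blast
qed

lemma involution_in_odd_subgroup:
  assumes H: "subgroup H G" and "odd (card H)" and c: "c \<in> H" "c \<otimes> c = \<one>"
  shows "c = \<one>"
proof (rule ccontr)
  assume "c \<noteq> \<one>"
  have cc: "c \<in> carrier G" using c(1) by (rule subgroup.mem_carrier[OF H])
  have "subgroup {\<one>, c} G"
    using cc c(2) by (intro subgroupI) (auto simp: inv_equality)
  moreover have "{\<one>, c} \<subseteq> H" using c(1) subgroup.one_closed[OF H] by simp
  ultimately have "card {\<one>, c} dvd card H" by (rule subgroup_card_dvd[OF _ H])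
  moreover have "card {\<one>, c} = 2" using \<open>c \<noteq> \<one>\<close> by simp
  ultimately show False using assms(2) by metis
qed

text \<open>The bounds force \<open>|C(x)| = 2 |Z|\<close>, so that all squares are central, and then \<open>|Z| \<le> 3\<close>.  A
  non-trivial commutator is an involution in the center, which excludes \<open>|Z| = 3\<close>.\<close>

lemma nontrivial_center_classification:
  assumes fin: "finite (carrier G)" and nc: "\<not> comm_group G" and Z: "card (center G) \<noteq> 1"
    and small: "\<forall>x \<in> carrier G - center G. card (centralizer G x) \<le> card (center G) + 3"
  shows "G \<cong> dihedral_group 4 \<or> G \<cong> quaternion_group"
proof -
  have central: "z \<in> carrier G" "g \<otimes> z = z \<otimes> g" if "z \<in> center G" "g \<in> carrier G" for z g
    using that by (simp_all add: center_def)
  have finZ: "finite (center G)" using fin by (simp add: center_def)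
  have "card (center G) \<noteq> 0"
    using finZ subgroup.one_closed[OF subgroup_center] by auto
  with Z have Z2: "2 \<le> card (center G)" by simp
  have twice: "card (centralizer G x) = 2 * card (center G)" if x: "x \<in> carrier G - center G" for x
  proof -
    obtain k where k: "card (centralizer G x) = card (center G) * k"
      using card_centralizer_noncentral(3)[OF fin x] by (auto elim: dvdE)
    have "card (center G) * k \<le> card (center G) + 3"
      using small x unfolding k[symmetric] by blast
    moreover have "card (center G) * 3 \<le> card (center G) * k" if "3 \<le> k" using that by simp
    ultimately have "k < 3" using Z2 by linarith
    moreover have "2 * card (center G) \<le> card (center G) * k"
      using card_centralizer_noncentral(1)[OF fin x] k by simp
    then have "2 \<le> k" using Z2 by (simp add: mult.commute)
    ultimately have "k = 2" by simp
    with k show ?thesis by simp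
  qed
  obtain x y where x: "x \<in> carrier G" and y: "y \<in> carrier G" and xy: "x \<otimes> y \<noteq> y \<otimes> x"
    using nc group_comm_groupI by blast
  have x': "x \<in> carrier G - center G" using x y xy by (auto simp: center_def)
  have squares: "g \<otimes> g \<in> center G" if g: "g \<in> carrier G" for g
  proof (cases "g \<in> center G")
    case True
    then show ?thesis by (simp add: subgroup.m_closed[OF subgroup_center])
  next
    case False
    have "finite (centralizer G g)" using fin by (simp add: centralizer_def)
    then show ?thesis
      using twice[of g] False g
      by (intro square_mem_index_two[OF subgroup_center subgroup_centralizer[OF g]]
          center_subset_centralizer in_centralizer_self) auto
  qed
  obtain z where z: "z \<in> center G" "z \<otimes> z = \<one>" "y \<otimes> x = z \<otimes> (x \<otimes> y)"
    using commutator_of_central_squares[OF squares x y] by blast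
  have z1: "z \<noteq> \<one>" using z(3) xy x y by auto
  have "card (center G) \<le> 3" using twice[OF x'] small x' by force
  moreover have "even (card (center G))"
    using involution_in_odd_subgroup[OF subgroup_center _ z(1,2)] z1 by blast
  ultimately have "card (center G) = 2" using Z2 by presburger
  moreover have "{\<one>, z} \<subseteq> center G" using z subgroup.one_closed[OF subgroup_center] by simp
  ultimately have center: "center G = {\<one>, z}"
    using z1 finZ by (intro card_subset_eq[symmetric]) auto
  have "order G = 8"
  proof -
    interpret C: group_action G "carrier G" conj_action by (rule action_by_conjugation)
    have zx: "z \<in> carrier G" "z \<otimes> x \<in> carrier G" using central(1)[OF z(1) x] x by auto
    have "orbit G conj_action x \<subseteq> {x, z \<otimes> x}"
    proof
      fix u assume "u \<in> orbit G conj_action x"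
      then obtain g where g: "g \<in> carrier G" and u: "u = g \<otimes> x \<otimes> inv g"
        using x by (auto simp: orbit_def)
      obtain c where c: "c \<in> center G" "g \<otimes> x = c \<otimes> (x \<otimes> g)"
        using commutator_of_central_squares[OF squares x g] by blast
      have "c \<in> carrier G" using central(1)[OF c(1) x] .
      then have "u = c \<otimes> x" using x g c(2) by (simp add: u m_assoc)
      with c(1) x show "u \<in> {x, z \<otimes> x}" by (auto simp: center)
    qed
    then have "card (orbit G conj_action x) \<le> card {x, z \<otimes> x}" by (intro card_mono) auto
    also have "\<dots> \<le> 2" by (simp add: card_insert_if)
    finally have "card (orbit G conj_action x) * 4 \<le> 8" by simp
    moreover have "card (centralizer G x) = 4" using twice[OF x'] center z1 by simp
    ultimately have "order G \<le> 8"
      using C.orbit_stabilizer_theorem[OF x] by (simp add: stabilizer_conj_action x)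
    moreover have "8 \<le> order G"
      using card_centralizer_noncentral(2)[OF fin x'] \<open>card (centralizer G x) = 4\<close> by simp
    ultimately show ?thesis by simp
  qed
  then show ?thesis
    using squares center by (intro order_eight_classification[OF z(1) z1 z(2) _ _ x y z(3)]) auto
qed

end

section \<open>The classification\<close>

context group
begin

lemma small_centralizers_if_order_le_nine:
  assumes "finite (carrier G)" "order G \<le> 9" "x \<in> carrier G - center G"
  shows "card (centralizer G x) \<le> card (center G) + 3"
proof -
  have "card (center G) \<noteq> 0"
    using assms(1) subgroup.one_closed[OF subgroup_center] by (auto simp: card_eq_0_iff center_def)
  moreover have "card (centralizer G x) \<le> 4"
    using card_centralizer_noncentral(2)[OF assms(1,3)] assms(2) by simp
  ultimately show ?thesis by simp
qed

text \<open>A proper divisor of 12 exceeding 4 is 6, and a centralizer of order 6 would have index two.\<close>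

lemma small_centralizers_if_iso_alt_group_4:
  assumes iso: "G \<cong> alt_group 4" and x: "x \<in> carrier G - center G"
  shows "card (centralizer G x) \<le> card (center G) + 3"
proof -
  obtain h where h: "h \<in> iso G (alt_group 4)" using iso by (auto simp: is_iso_def)
  have n: "order (alt_group 4) = 12" "order G = 12"
    using alt_group_card_carrier[of 4] iso_same_card[OF iso] by (simp_all add: order_def fact_numeral)
  have fin: "finite (carrier G)"
    using n(2) by (intro order_gt_0_iff_finite[THEN iffD1]) simp
  interpret h: group_hom G "alt_group 4" h
    using h by (simp add: group_hom_def group_hom_axioms_def alt_group_is_group iso_def)
  have C: "subgroup (centralizer G x) G" using x by (intro subgroup_centralizer) auto
  have "subgroup (h ` centralizer G x) (alt_group 4)" by (rule h.subgroup_img_is_subgroup[OF C])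
  then have "12 \<noteq> 2 * card (h ` centralizer G x)"
    using alt_group_no_index_two[of 4] n(1) by simp
  moreover have "card (h ` centralizer G x) = card (centralizer G x)"
    using h subgroup.subset[OF C] by (intro card_image) (auto simp: iso_iff intro: inj_on_subset)
  ultimately have "card (centralizer G x) \<noteq> 6" by simp
  moreover have "card (centralizer G x) \<le> 6"
    using card_centralizer_noncentral(2)[OF fin x] n(2) by simp
  moreover have "card (centralizer G x) \<noteq> 5"
  proof
    assume "card (centralizer G x) = 5"
    then have "5 dvd (12 :: nat)" using card_centralizer_noncentral(4)[OF fin x] n(2) by simp
    then show False by simp
  qed
  ultimately have "card (centralizer G x) \<le> 4" by linarith
  moreover have "card (center G) \<noteq> 0"
    using fin subgroup.one_closed[OF subgroup_center] by (auto simp: card_eq_0_iff center_def)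
  ultimately show ?thesis by simp
qed

end

theorem corollary1p5:
  fixes G :: "('a, 'b) monoid_scheme"
  assumes "group G"
    and "finite (carrier G)"
    and "\<not> comm_group G"
  shows "max_degree (with_proj (commuting_graph G)) \<le> 2 \<longleftrightarrow>
    G \<cong> sym_group 3 \<or> G \<cong> alt_group 4 \<or> G \<cong> dihedral_group 4 \<or> G \<cong> quaternion_group"
proof -
  interpret group G by (rule assms(1))
  have "(\<forall>x \<in> carrier G - center G. card (centralizer G x) \<le> card (center G) + 3) \<longleftrightarrow>
      G \<cong> sym_group 3 \<or> G \<cong> alt_group 4 \<or> G \<cong> dihedral_group 4 \<or> G \<cong> quaternion_group"
    (is "?small \<longleftrightarrow> ?list")
  proof
    assume ?small
    then show ?list
      using trivial_center_classification[OF assms(2,3)]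
        nontrivial_center_classification[OF assms(2,3)]
      by (cases "card (center G) = 1") auto
  next
    assume ?list
    then consider "G \<cong> alt_group 4"
      | "G \<cong> sym_group 3 \<or> G \<cong> dihedral_group 4 \<or> G \<cong> quaternion_group" by blast
    then show ?small
    proof cases
      case 1
      then show ?thesis using small_centralizers_if_iso_alt_group_4 by blast
    next
      case 2
      have "order (sym_group 3) = 6" "order (dihedral_group 4) = 8"
        by (simp_all add: order_def sym_group_card_carrier fact_numeral
            order_dihedral_group[unfolded order_def])
      then have "order G \<le> 9"
        using 2 order_quaternion_group iso_same_card[of G "sym_group 3"]
          iso_same_card[of G "dihedral_group 4"] iso_same_card[of G quaternion_group]
        unfolding order_def by auto
      then show ?thesis using small_centralizers_if_order_le_nine assms(2) by blast
    qed
  qed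
  then show ?thesis using max_degree_le_two_iff[OF assms(2,3)] by simp
qed

end
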